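(* Let $\varepsilon\in(0,1)$, $N_\varepsilon\ge1$ an integer, $\|f'\|<\infty$, and let $h\in[0,1]^{N_\varepsilon}$ be a random vector depending on the observations only through $(x_k^2+{x_k^*}^2)_k$. Then for every $x\in[0,\sqrt{N_\varepsilon/6}]$, $${\bf P}_{\vartheta,f}\Big(|\Phi_\varepsilon'(\vartheta,h)|>2x\varepsilon\big(\|f'\|+2\pi\varepsilon N_\varepsilon^{3/2}\big)\Big)\le2e^{-x^2}.$$
   Context: Model: $\vartheta\in\mathbb R$, $f$ locally square integrable, even, $1$-periodic; $f_k=\sqrt2\int_{-1/2}^{1/2}\cos(2\pi kt)f(t)dt$, $\|f'\|^2=\sum_{k\ge1}(2\pi k)^2f_k^2$. Observations $x_k=f_k\cos(2\pi k\vartheta)+\varepsilon\xi_k$, $x_k^*=f_k\sin(2\pi k\vartheta)+\varepsilon\xi_k^*$, $\xi_k,\xi_k^*$ i.i.d. $\mathcal N(0,1)$, law ${\bf P}_{\vartheta,f}$. $h\in[0,1]^N$ extended by $0$; $\Phi_\varepsilon(\tau,h)=\frac12\sum_kh_k(x_k\cos(2\pi k\tau)+x_k^*\sin(2\pi k\tau))^2$; $\Phi'_\varepsilon$ is the derivative in $\tau$. *)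

theory Defs
  imports "HOL-Probability.Probability"
begin

definition fcoef :: "(real \<Rightarrow> real) \<Rightarrow> nat \<Rightarrow> real" where
  "fcoef f k = sqrt 2 * (LBINT t=-1/2..1/2. cos (2 * pi * real k * t) * f t)"

text \<open>Squared norm of the derivative, defined spectrally as in the paper.\<close>
definition dnorm_sq :: "(real \<Rightarrow> real) \<Rightarrow> real" where
  "dnorm_sq f = (\<Sum>k. (2 * pi * real (Suc k))^2 * (fcoef f (Suc k))^2)"

definition dnorm :: "(real \<Rightarrow> real) \<Rightarrow> real" where
  "dnorm f = sqrt (dnorm_sq f)"

text \<open>Phi_eps(tau,h) for h supported on {1..N}: xo, xso are the observation sequences x_k, x_k^*.\<close>
definition Phi :: "nat \<Rightarrow> (nat \<Rightarrow> real) \<Rightarrow> (nat \<Rightarrow> real) \<Rightarrow> (nat \<Rightarrow> real) \<Rightarrow> real \<Rightarrow> real" where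
  "Phi N xo xso h \<tau> = (1/2) * (\<Sum>k\<in>{1..N}. h k * (xo k * cos (2 * pi * real k * \<tau>) + xso k * sin (2 * pi * real k * \<tau>))^2)"

end

theory Submission
  imports Defs
begin

text \<open>
  Rotating each pair \<open>(\<xi>\<^sub>k, \<xi>s\<^sub>k)\<close> by the angle \<open>2\<pi>k\<theta>\<close> gives independent standard Gaussian pairs
  \<open>(\<eta>\<^sub>k, \<eta>s\<^sub>k)\<close> for which \<open>\<Phi>'(\<theta>, h) = \<Sum> h\<^sub>k 2\<pi>k (f\<^sub>k + \<epsilon>\<eta>\<^sub>k) \<epsilon>\<eta>s\<^sub>k\<close>, while \<open>h\<close> is a function of
  \<open>(f\<^sub>k + \<epsilon>\<eta>\<^sub>k)\<^sup>2 + (\<epsilon>\<eta>s\<^sub>k)\<^sup>2\<close> and hence unchanged when the sign of one \<open>\<eta>s\<^sub>k\<close> is flipped. By this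
  symmetry the exponential moments of \<open>\<Phi>'\<close> can only grow when \<open>h\<close> is replaced by 1, and then they
  factor into explicit Gaussian integrals. The bound follows from Markov's inequality for
  \<open>exp (\<plusminus> l \<Phi>')\<close> with \<open>l = x / (\<epsilon> (\<parallel>f'\<parallel> + 2\<pi>\<epsilon>N\<^sup>3\<^sup>/\<^sup>2))\<close>; the range of \<open>x\<close> keeps these integrals finite.
\<close>

section \<open>Lebesgue-measure-preserving maps of the plane\<close>

lemma nn_integral_lborel_plane:
  fixes F :: "real \<times> real \<Rightarrow> ennreal"
  assumes [measurable]: "F \<in> borel_measurable borel"
  shows "(\<integral>\<^sup>+z. F z \<partial>lborel) = (\<integral>\<^sup>+x. \<integral>\<^sup>+y. F (x, y) \<partial>lborel \<partial>lborel)"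
    and "(\<integral>\<^sup>+z. F z \<partial>lborel) = (\<integral>\<^sup>+y. \<integral>\<^sup>+x. F (x, y) \<partial>lborel \<partial>lborel)"
proof -
  have m: "F \<in> borel_measurable (lborel \<Otimes>\<^sub>M lborel)"
    by (simp add: lborel_prod)
  show 1: "(\<integral>\<^sup>+z. F z \<partial>lborel) = (\<integral>\<^sup>+x. \<integral>\<^sup>+y. F (x, y) \<partial>lborel \<partial>lborel)"
    using lborel.nn_integral_fst[OF m] by (simp add: lborel_prod)
  show "(\<integral>\<^sup>+z. F z \<partial>lborel) = (\<integral>\<^sup>+y. \<integral>\<^sup>+x. F (x, y) \<partial>lborel \<partial>lborel)"
    unfolding 1 using lborel_pair.Fubini[OF m] by simp
qed

text \<open>This is \<open>distr lborel borel T = lborel\<close> in integrated form, the form in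
  which Fubini proves it and in which it composes.\<close>

definition lborel_invariant :: "(real \<times> real \<Rightarrow> real \<times> real) \<Rightarrow> bool" where
  "lborel_invariant T \<longleftrightarrow> T \<in> borel \<rightarrow>\<^sub>M borel \<and>
     (\<forall>F\<in>borel_measurable borel. (\<integral>\<^sup>+z. F (T z) \<partial>lborel) = (\<integral>\<^sup>+z. F z \<partial>lborel))"

lemma nn_integral_lborel_invariant:
  assumes "lborel_invariant T" "F \<in> borel_measurable borel"
  shows "(\<integral>\<^sup>+z. F (T z) \<partial>lborel) = (\<integral>\<^sup>+z. F z \<partial>lborel)"
  using assms unfolding lborel_invariant_def by blast

lemma lborel_invariant_comp:
  assumes "lborel_invariant S" "lborel_invariant T"
  shows "lborel_invariant (\<lambda>z. S (T z))"
  unfolding lborel_invariant_def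
proof (intro conjI ballI)
  show "(\<lambda>z. S (T z)) \<in> borel \<rightarrow>\<^sub>M borel"
    using assms measurable_compose[of T borel borel S borel] unfolding lborel_invariant_def by blast
next
  fix F :: "real \<times> real \<Rightarrow> ennreal" assume F: "F \<in> borel_measurable borel"
  then have FS: "(\<lambda>z. F (S z)) \<in> borel_measurable borel"
    using assms measurable_compose[of S borel borel F borel] unfolding lborel_invariant_def by blast
  show "(\<integral>\<^sup>+z. F (S (T z)) \<partial>lborel) = (\<integral>\<^sup>+z. F z \<partial>lborel)"
    using nn_integral_lborel_invariant[OF assms(2) FS] nn_integral_lborel_invariant[OF assms(1) F] by simp
qed

text \<open>For frozen \<open>x\<close> the map acts on \<open>y\<close> as an affine map of slope 1
  or -1, which preserves the inner integral. The case \<open>b = 1\<close> gives shears,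
  \<open>b = -1\<close> with \<open>a = 0\<close> a reflection.\<close>

lemma lborel_invariant_affine_snd:
  fixes a b :: real
  assumes "\<bar>b\<bar> = 1"
  shows "lborel_invariant (\<lambda>(x, y). (x, a * x + b * y))"
  unfolding lborel_invariant_def
proof safe
  show [measurable]: "(\<lambda>(x, y). (x, a * x + b * y)) \<in> borel \<rightarrow>\<^sub>M borel"
    unfolding borel_prod[symmetric] by measurable
  fix F :: "real \<times> real \<Rightarrow> ennreal" assume F[measurable]: "F \<in> borel_measurable borel"
  have F'[measurable]: "F \<in> borel_measurable (borel \<Otimes>\<^sub>M borel)" by (simp add: borel_prod)
  have *: "(\<integral>\<^sup>+y. F (x, a * x + b * y) \<partial>lborel) = (\<integral>\<^sup>+y. F (x, y) \<partial>lborel)" for x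
    using nn_integral_real_affine[of "\<lambda>y. F (x, y)" b "a * x"] assms by fastforce
  have "(\<integral>\<^sup>+z. F ((\<lambda>(x, y). (x, a * x + b * y)) z) \<partial>lborel) = (\<integral>\<^sup>+x. \<integral>\<^sup>+y. F (x, a * x + b * y) \<partial>lborel \<partial>lborel)"
    by (subst nn_integral_lborel_plane(1)) (auto)
  then show "(\<integral>\<^sup>+z. F ((\<lambda>(x, y). (x, a * x + b * y)) z) \<partial>lborel) = (\<integral>\<^sup>+z. F z \<partial>lborel)"
    by (simp add: * nn_integral_lborel_plane(1))
qed

lemma lborel_invariant_affine_fst:
  fixes a b :: real
  assumes "\<bar>b\<bar> = 1"
  shows "lborel_invariant (\<lambda>(x, y). (a * y + b * x, y))"
  unfolding lborel_invariant_def
proof safe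
  show [measurable]: "(\<lambda>(x, y). (a * y + b * x, y)) \<in> borel \<rightarrow>\<^sub>M borel"
    unfolding borel_prod[symmetric] by measurable
  fix F :: "real \<times> real \<Rightarrow> ennreal" assume F[measurable]: "F \<in> borel_measurable borel"
  have F'[measurable]: "F \<in> borel_measurable (borel \<Otimes>\<^sub>M borel)" by (simp add: borel_prod)
  have *: "(\<integral>\<^sup>+x. F (a * y + b * x, y) \<partial>lborel) = (\<integral>\<^sup>+x. F (x, y) \<partial>lborel)" for y
    using nn_integral_real_affine[of "\<lambda>x. F (x, y)" b "a * y"] assms by fastforce
  have "(\<integral>\<^sup>+z. F ((\<lambda>(x, y). (a * y + b * x, y)) z) \<partial>lborel) = (\<integral>\<^sup>+y. \<integral>\<^sup>+x. F (a * y + b * x, y) \<partial>lborel \<partial>lborel)"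
    by (subst nn_integral_lborel_plane(2)) (auto)
  then show "(\<integral>\<^sup>+z. F ((\<lambda>(x, y). (a * y + b * x, y)) z) \<partial>lborel) = (\<integral>\<^sup>+z. F z \<partial>lborel)"
    by (simp add: * nn_integral_lborel_plane(2))
qed

lemma lborel_invariant_rotation:
  fixes c s :: real
  assumes cs: "c\<^sup>2 + s\<^sup>2 = 1"
  shows "lborel_invariant (\<lambda>(x, y). (c * x - s * y, s * x + c * y))"
proof (cases "c = -1")
  \<comment> \<open>The half-angle tangent below would divide by zero here; the half turn is instead
    the product of the two coordinate reflections.\<close>
  case True
  then have "s = 0" using cs by simp
  have "lborel_invariant (\<lambda>z. (\<lambda>(x, y). (0 * y + (-1) * x, y)) ((\<lambda>(x, y). (x, 0 * x + (-1) * y)) z))"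
    by (rule lborel_invariant_comp[OF lborel_invariant_affine_fst lborel_invariant_affine_snd]) simp_all
  then show ?thesis
    using True \<open>s = 0\<close> by (simp add: case_prod_unfold)
next
  case False
  \<comment> \<open>a rotation by an angle other than \<open>\<pi>\<close> is a product of three shears\<close>
  define t where "t = s / (1 + c)"
  have ne: "1 + c \<noteq> 0" using False by auto
  \<comment> \<open>For \<open>c\<close> and \<open>s\<close> the cosine and sine of an angle,
    \<open>t\<close> is the tangent of half that angle. Multiplying out the shears with coefficients
    \<open>- t\<close>, \<open>s\<close>, \<open>- t\<close> needs only this identity and
    \<open>s * t = 1 - c\<close>.\<close>
  have t1: "t * (1 + c) = s" using ne by (simp add: t_def)
  have "s * t * (1 + c) = (1 - c) * (1 + c)"
    using cs t1 by (simp add: algebra_simps power2_eq_square)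
  then have t2: "s * t = 1 - c" using ne by simp
  have "lborel_invariant (\<lambda>z. (\<lambda>(x, y). (- t * y + 1 * x, y))
    ((\<lambda>(x, y). (x, s * x + 1 * y)) ((\<lambda>(x, y). (- t * y + 1 * x, y)) z)))"
    by (rule lborel_invariant_comp[OF lborel_invariant_affine_fst
          lborel_invariant_comp[OF lborel_invariant_affine_snd lborel_invariant_affine_fst]]) simp_all
  also have "(\<lambda>z. (\<lambda>(x, y). (- t * y + 1 * x, y))
    ((\<lambda>(x, y). (x, s * x + 1 * y)) ((\<lambda>(x, y). (- t * y + 1 * x, y)) z)))
    = (\<lambda>(x, y). (c * x - s * y, s * x + c * y))"
  proof (rule ext)
    fix z :: "real \<times> real"
    obtain x y where z: "z = (x, y)" by (cases z)
    have y': "s * (- t * y + 1 * x) + 1 * y = s * x + c * y"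
    proof -
      have "s * (- t * y + 1 * x) + 1 * y = s * x + y - (s * t) * y" by (simp add: algebra_simps)
      then show ?thesis by (simp add: t2 algebra_simps)
    qed
    have "- t * (s * x + c * y) + 1 * (- t * y + 1 * x) = x - (s * t) * x - (t * (1 + c)) * y"
      by (simp add: algebra_simps)
    also have "\<dots> = c * x - s * y"
      unfolding t1 t2 by (simp add: algebra_simps)
    finally have x': "- t * (s * x + c * y) + 1 * (- t * y + 1 * x) = c * x - s * y" .
    show "(\<lambda>(x, y). (- t * y + 1 * x, y))
      ((\<lambda>(x, y). (x, s * x + 1 * y)) ((\<lambda>(x, y). (- t * y + 1 * x, y)) z))
      = (\<lambda>(x, y). (c * x - s * y, s * x + c * y)) z"
      unfolding z prod.case y' x' ..
  qed
  finally show ?thesis .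
qed

section \<open>The standard Gaussian measure on the plane and its isometries\<close>

text \<open>A density with respect to planar Lebesgue measure, rather than a product of two laws, so
  that maps preserving \<open>lborel\<close> can be applied to it directly.\<close>

definition gauss_plane :: "(real \<times> real) measure" where
  "gauss_plane = density lborel (\<lambda>(x, y). ennreal (std_normal_density x) * ennreal (std_normal_density y))"

lemma sets_gauss_plane [simp, measurable_cong]: "sets gauss_plane = sets borel"
  by (simp add: gauss_plane_def)

lemma std_normal_product_measurable [measurable]:
  "(\<lambda>(x, y). ennreal (std_normal_density x) * ennreal (std_normal_density y)) \<in> borel_measurable borel"
  unfolding borel_prod[symmetric] by measurable

lemma nn_integral_gauss_plane:
  assumes [measurable]: "F \<in> borel_measurable borel"
  shows "(\<integral>\<^sup>+z. F z \<partial>gauss_plane) =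
    (\<integral>\<^sup>+x. ennreal (std_normal_density x) * (\<integral>\<^sup>+y. ennreal (std_normal_density y) * F (x, y) \<partial>lborel) \<partial>lborel)"
proof -
  have F'[measurable]: "F \<in> borel_measurable (borel \<Otimes>\<^sub>M borel)" by (simp add: borel_prod)
  have "(\<integral>\<^sup>+z. F z \<partial>gauss_plane) = (\<integral>\<^sup>+x. \<integral>\<^sup>+y. ennreal (std_normal_density x) * (ennreal (std_normal_density y) * F (x, y)) \<partial>lborel \<partial>lborel)"
    unfolding gauss_plane_def
    by (subst nn_integral_density) (auto simp: nn_integral_lborel_plane(1) mult.assoc)
  also have "\<dots> = (\<integral>\<^sup>+x. ennreal (std_normal_density x) * (\<integral>\<^sup>+y. ennreal (std_normal_density y) * F (x, y) \<partial>lborel) \<partial>lborel)"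
    by (intro nn_integral_cong nn_integral_cmult) simp
  finally show ?thesis .
qed

text \<open>The density depends on \<open>(x, y)\<close> only through
  \<open>x\<^sup>2 + y\<^sup>2\<close>, so it is unchanged under \<open>T\<close>, and the Lebesgue
  part is preserved by assumption.\<close>

lemma distr_gauss_plane_isometry:
  assumes T: "lborel_invariant T"
    and iso: "\<And>z. (fst (T z))\<^sup>2 + (snd (T z))\<^sup>2 = (fst z)\<^sup>2 + (snd z)\<^sup>2"
  shows "distr gauss_plane borel T = gauss_plane"
proof (rule measure_eqI)
  let ?d = "\<lambda>(x, y). ennreal (std_normal_density x) * ennreal (std_normal_density y)"
  have [measurable]: "T \<in> borel \<rightarrow>\<^sub>M borel" using T by (simp add: lborel_invariant_def)
  have "?d z = ennreal (1 / (2 * pi) * exp (- ((fst z)\<^sup>2 + (snd z)\<^sup>2) / 2))" for z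
    by (simp add: case_prod_beta std_normal_density_def ennreal_mult'[symmetric] exp_add[symmetric] 
        diff_divide_distrib add_divide_distrib)
  then have d: "?d (T z) = ?d z" for z by (simp only: iso)
  fix A assume "A \<in> sets (distr gauss_plane borel T)"
  then have A[measurable]: "A \<in> sets borel" by simp
  have "emeasure (distr gauss_plane borel T) A = (\<integral>\<^sup>+z. indicator A (T z) \<partial>gauss_plane)"
    by (subst nn_integral_indicator[symmetric]) (simp_all add: nn_integral_distr del: nn_integral_indicator)
  also have "\<dots> = (\<integral>\<^sup>+z. ?d (T z) * indicator A (T z) \<partial>lborel)"
    unfolding d gauss_plane_def by (subst nn_integral_density) simp_all
  also have "\<dots> = (\<integral>\<^sup>+z. ?d z * indicator A z \<partial>lborel)"
    by (rule nn_integral_lborel_invariant[OF T]) measurable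
  also have "\<dots> = emeasure gauss_plane A"
    unfolding gauss_plane_def by (subst emeasure_density) simp_all
  finally show "emeasure (distr gauss_plane borel T) A = emeasure gauss_plane A" .
qed simp

lemma distr_gauss_plane_rotation:
  fixes c s :: real
  assumes cs: "c\<^sup>2 + s\<^sup>2 = 1"
  shows "distr gauss_plane borel (\<lambda>(x, y). (c * x - s * y, s * x + c * y)) = gauss_plane"
proof (rule distr_gauss_plane_isometry[OF lborel_invariant_rotation[OF cs]])
  fix z :: "real \<times> real"
  obtain x y where z: "z = (x, y)" by (cases z)
  have "(c * x - s * y)\<^sup>2 + (s * x + c * y)\<^sup>2 = (c\<^sup>2 + s\<^sup>2) * (x\<^sup>2 + y\<^sup>2)"
    by (simp add: power2_eq_square algebra_simps)
  then show "(fst ((\<lambda>(x, y). (c * x - s * y, s * x + c * y)) z))\<^sup>2 + (snd ((\<lambda>(x, y). (c * x - s * y, s * x + c * y)) z))\<^sup>2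
    = (fst z)\<^sup>2 + (snd z)\<^sup>2"
    using cs z by simp
qed

lemma distr_gauss_plane_reflection:
  "distr gauss_plane borel (\<lambda>(x, y). (x, - y)) = gauss_plane"
  using distr_gauss_plane_isometry[OF lborel_invariant_affine_snd[of "-1" 0]]
  by (simp add: case_prod_beta)

section \<open>Gaussian integrals of exponentials of quadratic forms\<close>

text \<open>Completing the square turns the integrand into a constant times the normal density of
  mean \<open>p / (1 - q)\<close> and variance \<open>1 / (1 - q)\<close>; \<open>q < 1\<close>
  makes this variance positive.\<close>

lemma nn_integral_exp_quadratic_std_normal:
  fixes p q :: real
  assumes q: "q < 1"
  shows "(\<integral>\<^sup>+x. ennreal (std_normal_density x) * ennreal (exp (p * x + q * x\<^sup>2 / 2)) \<partial>lborel)
    = ennreal (exp (p\<^sup>2 / (2 * (1 - q))) / sqrt (1 - q))"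
proof -
  define \<sigma> where "\<sigma> = 1 / sqrt (1 - q)"
  have \<sigma>: "\<sigma> > 0" "\<sigma>\<^sup>2 = 1 / (1 - q)" using q by (auto simp: \<sigma>_def power_divide)
  have complete_square: "p * x - d * x\<^sup>2 / 2 = p\<^sup>2 / (2 * d) - d * (x - p / d)\<^sup>2 / 2" if "d > 0" for d x :: real
    using that by (simp add: field_simps power2_eq_square)
  have e: "std_normal_density x * exp (p * x + q * x\<^sup>2 / 2)
    = exp (p\<^sup>2 / (2 * (1 - q))) / sqrt (1 - q) * normal_density (p / (1 - q)) \<sigma> x" for x
  proof -
    have "- x\<^sup>2 / 2 + (p * x + q * x\<^sup>2 / 2) = p\<^sup>2 / (2 * (1 - q)) + - (x - p / (1 - q))\<^sup>2 / (2 * \<sigma>\<^sup>2)"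
    proof -
      have "- x\<^sup>2 / 2 + (p * x + q * x\<^sup>2 / 2) = p * x - (1 - q) * x\<^sup>2 / 2"
        by (simp add: field_simps)
      also have "\<dots> = p\<^sup>2 / (2 * (1 - q)) - (1 - q) * (x - p / (1 - q))\<^sup>2 / 2"
        using complete_square[of "1 - q"] q by simp
      finally show ?thesis unfolding \<sigma>(2) by simp
    qed
    moreover have "sqrt (2 * pi * \<sigma>\<^sup>2) = sqrt (2 * pi) / sqrt (1 - q)"
      unfolding \<sigma>(2) using q by (simp add: real_sqrt_divide real_sqrt_mult)
    ultimately show ?thesis
      using q unfolding std_normal_density_def normal_density_def
      by (simp add: exp_add[symmetric] mult.assoc)
  qed
  have "(\<integral>\<^sup>+x. ennreal (normal_density (p / (1 - q)) \<sigma> x) \<partial>lborel) = 1"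
    using \<sigma>(1) by (subst nn_integral_eq_integral) auto
  then have "(\<integral>\<^sup>+x. ennreal C * ennreal (normal_density (p / (1 - q)) \<sigma> x) \<partial>lborel) = ennreal C" for C
    by (subst nn_integral_cmult) auto
  moreover have "ennreal (std_normal_density x) * ennreal (exp (p * x + q * x\<^sup>2 / 2))
    = ennreal (exp (p\<^sup>2 / (2 * (1 - q))) / sqrt (1 - q)) * ennreal (normal_density (p / (1 - q)) \<sigma> x)" for x
    using q by (simp only: ennreal_mult''[symmetric] normal_density_nonneg exp_ge_zero e)
  ultimately show ?thesis by simp
qed

text \<open>Integrating out the second coordinate leaves
  \<open>exp (a\<^sup>2 * (b + e * x)\<^sup>2 / 2)\<close>, again the exponential of a quadratic in
  \<open>x\<close>. The exact value is \<open>exp (a\<^sup>2 * b\<^sup>2 / (2 * (1 - \<mu>))) / sqrt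
  (1 - \<mu>)\<close> with \<open>\<mu> = a\<^sup>2 * e\<^sup>2\<close>.\<close>

lemma nn_integral_exp_product_gauss_plane_le:
  fixes a b e :: real
  assumes ae: "a\<^sup>2 * e\<^sup>2 \<le> 1/6"
  shows "(\<integral>\<^sup>+z. ennreal (exp (a * (b + e * fst z) * snd z)) \<partial>gauss_plane)
    \<le> ennreal (exp (3/5 * (a\<^sup>2 * b\<^sup>2 + a\<^sup>2 * e\<^sup>2)))"
proof -
  define \<mu> where "\<mu> = a\<^sup>2 * e\<^sup>2"
  have \<mu>: "0 \<le> \<mu>" "\<mu> \<le> 1/6" using ae by (auto simp: \<mu>_def)
  have inner: "(\<integral>\<^sup>+y. ennreal (std_normal_density y) * ennreal (exp (a * (b + e * x) * y)) \<partial>lborel)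
     = ennreal (exp (a\<^sup>2 * b\<^sup>2 / 2)) * ennreal (exp ((a\<^sup>2 * b * e) * x + \<mu> * x\<^sup>2 / 2))" for x
    using nn_integral_exp_quadratic_std_normal[of 0 "a * (b + e * x)"]
    by (simp add: ennreal_mult'[symmetric] exp_add[symmetric] \<mu>_def power2_eq_square field_simps)
  have m: "(\<lambda>z. ennreal (exp (a * (b + e * fst z) * snd z))) \<in> borel_measurable (borel :: (real \<times> real) measure)"
    unfolding borel_prod[symmetric] by measurable
  have "(\<integral>\<^sup>+z. ennreal (exp (a * (b + e * fst z) * snd z)) \<partial>gauss_plane)
    = (\<integral>\<^sup>+x. ennreal (exp (a\<^sup>2 * b\<^sup>2 / 2)) *
        (ennreal (std_normal_density x) * ennreal (exp ((a\<^sup>2 * b * e) * x + \<mu> * x\<^sup>2 / 2))) \<partial>lborel)"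
    unfolding nn_integral_gauss_plane[OF m] fst_conv snd_conv inner by (simp add: mult_ac)
  also have "\<dots> = ennreal (exp (a\<^sup>2 * b\<^sup>2 / 2)) *
      ennreal (exp ((a\<^sup>2 * b * e)\<^sup>2 / (2 * (1 - \<mu>))) / sqrt (1 - \<mu>))"
    using \<mu> by (subst nn_integral_cmult) (simp_all only: nn_integral_exp_quadratic_std_normal, measurable)
  also have "\<dots> = ennreal (exp (a\<^sup>2 * b\<^sup>2 / 2) * (exp ((a\<^sup>2 * b * e)\<^sup>2 / (2 * (1 - \<mu>))) / sqrt (1 - \<mu>)))"
    using \<mu> by (subst ennreal_mult') simp_all
  also have "\<dots> \<le> ennreal (exp (3/5 * (a\<^sup>2 * b\<^sup>2 + a\<^sup>2 * e\<^sup>2)))"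
  proof (rule ennreal_leI)
    \<comment> \<open>The normalising factor is moved into the exponent, where it gets the same
      coefficient \<open>1 / (2 * (1 - \<mu>))\<close> as the term
      \<open>a\<^sup>2 * b\<^sup>2\<close>.\<close>
    have "1 / (1 - \<mu>) = 1 + \<mu> / (1 - \<mu>)" using \<mu> by (simp add: field_simps)
    also have "\<dots> \<le> exp (\<mu> / (1 - \<mu>))" by (rule exp_ge_add_one_self)
    finally have "sqrt (1 / (1 - \<mu>)) \<le> sqrt (exp (\<mu> / (1 - \<mu>)))" by simp
    also have "\<dots> = exp (\<mu> / (1 - \<mu>) / 2)"
    proof -
      have "sqrt (exp t) = exp (t / 2)" for t :: real
        by (rule real_sqrt_unique) (simp_all add: exp_double[symmetric])
      then show ?thesis .
    qed
    finally have s: "1 / sqrt (1 - \<mu>) \<le> exp (\<mu> / (1 - \<mu>) / 2)" by (simp add: real_sqrt_divide)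
    \<comment> \<open>The constant 3/5 is the value of this coefficient at the extreme point
      \<open>\<mu> = 1/6\<close>.\<close>
    have "1 / (2 * (1 - \<mu>)) \<le> 3/5" using \<mu> by (simp add: field_simps)
    then have k: "(a\<^sup>2 * b\<^sup>2 + \<mu>) * (1 / (2 * (1 - \<mu>))) \<le> (a\<^sup>2 * b\<^sup>2 + \<mu>) * (3/5)"
      by (rule mult_left_mono) (use \<mu> in auto)
    have sum: "a\<^sup>2 * b\<^sup>2 / 2 + (a\<^sup>2 * b * e)\<^sup>2 / (2 * (1 - \<mu>)) + \<mu> / (1 - \<mu>) / 2
      = (a\<^sup>2 * b\<^sup>2 + \<mu>) * (1 / (2 * (1 - \<mu>)))"
    proof -
      have "(a\<^sup>2 * b * e)\<^sup>2 = a\<^sup>2 * b\<^sup>2 * \<mu>" by (simp add: \<mu>_def power2_eq_square)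
      moreover have "t / 2 + t * \<mu> / (2 * d) + \<mu> / d / 2 = (t + \<mu>) * (1 / (2 * d))"
        if "d = 1 - \<mu>" "d > 0" for d t
        using that(2) by (simp add: field_simps) (simp add: that(1) algebra_simps)
      ultimately show ?thesis using \<mu> by simp
    qed
    have "exp (a\<^sup>2 * b\<^sup>2 / 2) * (exp ((a\<^sup>2 * b * e)\<^sup>2 / (2 * (1 - \<mu>))) * (1 / sqrt (1 - \<mu>)))
      \<le> exp (a\<^sup>2 * b\<^sup>2 / 2) * (exp ((a\<^sup>2 * b * e)\<^sup>2 / (2 * (1 - \<mu>))) * exp (\<mu> / (1 - \<mu>) / 2))"
      by (intro mult_left_mono s) auto
    also have "\<dots> = exp ((a\<^sup>2 * b\<^sup>2 + \<mu>) * (1 / (2 * (1 - \<mu>))))"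
      unfolding sum[symmetric] by (simp only: exp_add mult.assoc)
    also have "\<dots> \<le> exp (3/5 * (a\<^sup>2 * b\<^sup>2 + a\<^sup>2 * e\<^sup>2))"
      using k by (simp add: \<mu>_def algebra_simps)
    finally show "exp (a\<^sup>2 * b\<^sup>2 / 2) * (exp ((a\<^sup>2 * b * e)\<^sup>2 / (2 * (1 - \<mu>))) / sqrt (1 - \<mu>))
      \<le> exp (3/5 * (a\<^sup>2 * b\<^sup>2 + a\<^sup>2 * e\<^sup>2))" by simp
  qed
  finally show ?thesis .
qed

section \<open>Removing weights by sign symmetry\<close>

text \<open>Both sides are twice a hyperbolic cosine, which is even and increasing on the
  nonnegative reals.\<close>

lemma exp_add_exp_minus_mono:
  fixes a b :: real
  assumes "\<bar>a\<bar> \<le> \<bar>b\<bar>"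
  shows "exp a + exp (- a) \<le> exp b + exp (- b)"
proof -
  have "cosh \<bar>a\<bar> \<le> cosh \<bar>b\<bar>"
    using assms by (subst cosh_real_nonneg_le_iff) auto
  then show ?thesis by (simp add: cosh_def abs_if algebra_simps split: if_splits)
qed

text \<open>Applying \<open>\<sigma>\<close> to coordinate \<open>j\<close> preserves independence
  and every marginal law. The joint law is the product of the marginals, so it does not change
  either.\<close>

lemma (in prob_space) nn_integral_replace_coordinate:
  assumes indep: "indep_vars (\<lambda>_. E) Q I" and j: "j \<in> I"
    and \<sigma>: "\<sigma> \<in> E \<rightarrow>\<^sub>M E" and law: "distr M E (\<lambda>\<omega>. \<sigma> (Q j \<omega>)) = distr M E (Q j)"
    and F: "F \<in> borel_measurable (Pi\<^sub>M I (\<lambda>_. E))"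
  shows "(\<integral>\<^sup>+\<omega>. F ((\<lambda>i\<in>I. Q i \<omega>)(j := \<sigma> (Q j \<omega>))) \<partial>M) = (\<integral>\<^sup>+\<omega>. F (\<lambda>i\<in>I. Q i \<omega>) \<partial>M)"
proof -
  define Q' where "Q' = (\<lambda>i \<omega>. (if i = j then \<sigma> else (\<lambda>x. x)) (Q i \<omega>))"
  have indep': "indep_vars (\<lambda>_. E) Q' I"
    unfolding Q'_def by (rule indep_vars_compose2[OF indep]) (use \<sigma> in auto)
  have rv: "random_variable E (Q i)" "random_variable E (Q' i)" if "i \<in> I" for i
    using indep indep' that by (auto simp: indep_vars_def)
  have "I \<noteq> {}" using j by auto
  have "distr M (Pi\<^sub>M I (\<lambda>_. E)) (\<lambda>\<omega>. \<lambda>i\<in>I. Q' i \<omega>) = (\<Pi>\<^sub>M i\<in>I. distr M E (Q' i))"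
    using indep' by (subst indep_vars_iff_distr_eq_PiM'[symmetric]) (auto simp: \<open>I \<noteq> {}\<close> rv)
  also have "\<dots> = (\<Pi>\<^sub>M i\<in>I. distr M E (Q i))"
    by (intro PiM_cong) (auto simp: Q'_def law)
  also have "\<dots> = distr M (Pi\<^sub>M I (\<lambda>_. E)) (\<lambda>\<omega>. \<lambda>i\<in>I. Q i \<omega>)"
    using indep by (intro sym[OF iffD1[OF indep_vars_iff_distr_eq_PiM']]) (auto simp: \<open>I \<noteq> {}\<close> rv)
  finally have D: "distr M (Pi\<^sub>M I (\<lambda>_. E)) (\<lambda>\<omega>. \<lambda>i\<in>I. Q' i \<omega>)
    = distr M (Pi\<^sub>M I (\<lambda>_. E)) (\<lambda>\<omega>. \<lambda>i\<in>I. Q i \<omega>)" .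
  have "(\<integral>\<^sup>+\<omega>. F (\<lambda>i\<in>I. Q' i \<omega>) \<partial>M) = (\<integral>\<^sup>+z. F z \<partial>distr M (Pi\<^sub>M I (\<lambda>_. E)) (\<lambda>\<omega>. \<lambda>i\<in>I. Q' i \<omega>))"
    by (subst nn_integral_distr) (intro measurable_restrict rv, assumption, simp_all add: F)
  also have "\<dots> = (\<integral>\<^sup>+\<omega>. F (\<lambda>i\<in>I. Q i \<omega>) \<partial>M)"
    unfolding D by (subst nn_integral_distr) (intro measurable_restrict rv, assumption, simp_all add: F)
  finally have "(\<integral>\<^sup>+\<omega>. F (\<lambda>i\<in>I. Q' i \<omega>) \<partial>M) = (\<integral>\<^sup>+\<omega>. F (\<lambda>i\<in>I. Q i \<omega>) \<partial>M)" .
  moreover have "(\<lambda>i\<in>I. Q' i \<omega>) = (\<lambda>i\<in>I. Q i \<omega>)(j := \<sigma> (Q j \<omega>))" for \<omega>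
    using j by (auto simp: Q'_def fun_eq_iff)
  ultimately show ?thesis by simp
qed

text \<open>Averaging over a sign flip turns \<open>exp (w g)\<close> into \<open>cosh (w g) \<le> cosh g\<close>, so the weights can be
  replaced by 1 one index at a time.\<close>
lemma (in prob_space) nn_integral_exp_weighted_odd_sum_le:
  fixes g :: "'i \<Rightarrow> 'b \<Rightarrow> real" and w :: "'i \<Rightarrow> ('i \<Rightarrow> 'b) \<Rightarrow> real"
  assumes indep: "indep_vars (\<lambda>_. E) Q I" and K: "finite K" "K \<subseteq> I"
    and \<sigma>: "\<sigma> \<in> E \<rightarrow>\<^sub>M E"
    and law: "\<And>k. k \<in> K \<Longrightarrow> distr M E (\<lambda>\<omega>. \<sigma> (Q k \<omega>)) = distr M E (Q k)"
    and g: "\<And>k. k \<in> K \<Longrightarrow> g k \<in> borel_measurable E"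
    and odd: "\<And>k z. k \<in> K \<Longrightarrow> g k (\<sigma> z) = - g k z"
    and w: "\<And>k. k \<in> K \<Longrightarrow> w k \<in> borel_measurable (Pi\<^sub>M I (\<lambda>_. E))"
    and w01: "\<And>k z. k \<in> K \<Longrightarrow> 0 \<le> w k z \<and> w k z \<le> 1"
    and w_inv: "\<And>k j z. k \<in> K \<Longrightarrow> j \<in> K \<Longrightarrow> w k (z(j := \<sigma> (z j))) = w k z"
  shows "(\<integral>\<^sup>+\<omega>. ennreal (exp (\<Sum>k\<in>K. w k (\<lambda>i\<in>I. Q i \<omega>) * g k (Q k \<omega>))) \<partial>M)
    \<le> (\<integral>\<^sup>+\<omega>. ennreal (exp (\<Sum>k\<in>K. g k (Q k \<omega>))) \<partial>M)"
proof -
  define Z where "Z = (\<lambda>\<omega>. \<lambda>i\<in>I. Q i \<omega>)"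
  have rv: "random_variable E (Q i)" if "i \<in> I" for i
    using indep that by (auto simp: indep_vars_def)
  have Z_meas[measurable]: "Z \<in> M \<rightarrow>\<^sub>M Pi\<^sub>M I (\<lambda>_. E)"
    unfolding Z_def by (auto intro!: measurable_restrict rv)
  have gm: "(\<lambda>z. g k (z k)) \<in> borel_measurable (Pi\<^sub>M I (\<lambda>_. E))" if "k \<in> K" for k
    using that K by (intro measurable_compose[of "\<lambda>z. z k" _ E "g k"] measurable_component_singleton g) auto
  \<comment> \<open>Interpolation between the two sides: indices in \<open>J\<close> carry their
    true weight, all others weight 1. The induction moves from \<open>J = {}\<close> to
    \<open>J = K\<close>.\<close>
  define v where "v = (\<lambda>J k z. if k \<in> J then w k z else 1)"
  have vm: "v J k \<in> borel_measurable (Pi\<^sub>M I (\<lambda>_. E))" if "k \<in> K" for k J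
    using w[OF that] by (cases "k \<in> J") (auto simp: v_def[abs_def])
  define S where "S = (\<lambda>J z. \<Sum>k\<in>K. v J k z * g k (z k))"
  have "(\<integral>\<^sup>+\<omega>. ennreal (exp (S J (Z \<omega>))) \<partial>M) \<le> (\<integral>\<^sup>+\<omega>. ennreal (exp (S {} (Z \<omega>))) \<partial>M)" if "J \<subseteq> K" for J
    using finite_subset[OF that K(1)] that
  proof (induction J rule: finite_induct)
    case (insert j J)
    then have j: "j \<in> K" "j \<in> I" "J \<subseteq> K" "j \<notin> J" using K by auto
    define R where "R = (\<lambda>z. \<Sum>k\<in>K - {j}. v J k z * g k (z k))"
    have Rm[measurable]: "R \<in> borel_measurable (Pi\<^sub>M I (\<lambda>_. E))"
      unfolding R_def by (auto intro!: borel_measurable_sum borel_measurable_times gm vm)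
    note [measurable] = w[OF j(1)] gm[OF j(1)]
    have S1: "S (insert j J) z = w j z * g j (z j) + R z" for z
      unfolding S_def R_def
      by (subst sum.remove[OF K(1) j(1)]) (auto simp: v_def intro!: sum.cong)
    have S0: "S J z = g j (z j) + R z" for z
      unfolding S_def R_def using j(4)
      by (subst sum.remove[OF K(1) j(1)]) (auto simp: v_def intro!: sum.cong)
    let ?f = "\<lambda>z :: 'i \<Rightarrow> 'b. z(j := \<sigma> (z j))"
    \<comment> \<open>The remainder contains only \<open>g k (z k)\<close> with \<open>k\<close>
      different from \<open>j\<close>, and all its weights are invariant under the flip.\<close>
    have R_inv: "R (?f z) = R z" for z
      unfolding R_def by (intro sum.cong refl) (auto simp: v_def w_inv j)
    have flip: "(\<integral>\<^sup>+\<omega>. ennreal (exp (u (Z \<omega>) * g j (Z \<omega> j) + R (Z \<omega>))) \<partial>M)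
      = (\<integral>\<^sup>+\<omega>. ennreal (exp (- (u (Z \<omega>) * g j (Z \<omega> j)) + R (Z \<omega>))) \<partial>M)"
      if [measurable]: "u \<in> borel_measurable (Pi\<^sub>M I (\<lambda>_. E))" and u: "\<And>z. u (?f z) = u z" for u
    proof -
      have m: "(\<lambda>z. ennreal (exp (u z * g j (z j) + R z))) \<in> borel_measurable (Pi\<^sub>M I (\<lambda>_. E))"
        by measurable
      have "Z \<omega> j = Q j \<omega>" for \<omega> using j by (simp add: Z_def)
      then have "(\<integral>\<^sup>+\<omega>. ennreal (exp (u (?f (Z \<omega>)) * g j (?f (Z \<omega>) j) + R (?f (Z \<omega>)))) \<partial>M)
         = (\<integral>\<^sup>+\<omega>. ennreal (exp (u (Z \<omega>) * g j (Z \<omega> j) + R (Z \<omega>))) \<partial>M)"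
        using nn_integral_replace_coordinate[OF indep j(2) \<sigma> law[OF j(1)] m] by (simp add: Z_def)
      then show ?thesis by (simp add: u R_inv odd[OF j(1)])
    qed
    \<comment> \<open>Adding the integral to its flipped copy symmetrises the integrand; keeping the
      factor 2 avoids a division in \<open>ennreal\<close>.\<close>
    have double: "2 * (\<integral>\<^sup>+\<omega>. ennreal (exp (u (Z \<omega>) * g j (Z \<omega> j) + R (Z \<omega>))) \<partial>M)
      = (\<integral>\<^sup>+\<omega>. ennreal ((exp (u (Z \<omega>) * g j (Z \<omega> j)) + exp (- (u (Z \<omega>) * g j (Z \<omega> j)))) * exp (R (Z \<omega>))) \<partial>M)"
      if [measurable]: "u \<in> borel_measurable (Pi\<^sub>M I (\<lambda>_. E))" and u: "\<And>z. u (?f z) = u z" for u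
    proof -
      have "2 * (\<integral>\<^sup>+\<omega>. ennreal (exp (u (Z \<omega>) * g j (Z \<omega> j) + R (Z \<omega>))) \<partial>M)
       = (\<integral>\<^sup>+\<omega>. ennreal (exp (u (Z \<omega>) * g j (Z \<omega> j) + R (Z \<omega>))) \<partial>M)
        + (\<integral>\<^sup>+\<omega>. ennreal (exp (- (u (Z \<omega>) * g j (Z \<omega> j)) + R (Z \<omega>))) \<partial>M)"
        using flip[of u, OF that] by (simp add: mult_2)
      also have "\<dots> = (\<integral>\<^sup>+\<omega>. ennreal (exp (u (Z \<omega>) * g j (Z \<omega> j) + R (Z \<omega>)))
         + ennreal (exp (- (u (Z \<omega>) * g j (Z \<omega> j)) + R (Z \<omega>))) \<partial>M)"
        by (rule nn_integral_add[symmetric]) measurable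
      finally show ?thesis
        by (simp only: exp_add distrib_right ennreal_plus exp_ge_zero mult_nonneg_nonneg)
    qed
    have "2 * (\<integral>\<^sup>+\<omega>. ennreal (exp (S (insert j J) (Z \<omega>))) \<partial>M)
      \<le> 2 * (\<integral>\<^sup>+\<omega>. ennreal (exp (S J (Z \<omega>))) \<partial>M)"
    proof -
      have "exp (w j z * g j y) + exp (- (w j z * g j y)) \<le> exp (g j y) + exp (- g j y)" for z y
        by (rule exp_add_exp_minus_mono) (use w01[OF j(1), of z] in \<open>auto simp: abs_mult intro!: mult_left_le_one_le\<close>)
      then show ?thesis
        \<comment> \<open>The same symmetrisation is used with the true weight and with the constant
          weight 1, and the two integrands are compared pointwise.\<close>
        unfolding S1 S0 using double[of "w j"] double[of "\<lambda>_. 1"] w[OF j(1)] w_inv[OF j(1) j(1)]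
        by (auto intro!: nn_integral_mono ennreal_leI mult_right_mono)
    qed
    then have "(\<integral>\<^sup>+\<omega>. ennreal (exp (S (insert j J) (Z \<omega>))) \<partial>M) \<le> (\<integral>\<^sup>+\<omega>. ennreal (exp (S J (Z \<omega>))) \<partial>M)"
      by (simp add: ennreal_mult_le_mult_iff)
    also have "\<dots> \<le> (\<integral>\<^sup>+\<omega>. ennreal (exp (S {} (Z \<omega>))) \<partial>M)"
      using insert by auto
    finally show ?case .
  qed simp
  from this[OF order_refl] show ?thesis
    using K(2) by (simp add: S_def v_def Z_def subset_iff cong: sum.cong)
qed

section \<open>Independent Gaussian pairs\<close>

lemma (in prob_space) distr_std_normal_pair:
  assumes X: "distributed M lborel X std_normal_density" and Y: "distributed M lborel Y std_normal_density"
    and indep: "indep_var borel X borel Y"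
  shows "distr M borel (\<lambda>\<omega>. (X \<omega>, Y \<omega>)) = gauss_plane"
proof -
  have "indep_var lborel X lborel Y"
    using indep_var_compose[OF indep, of "\<lambda>x. x" lborel "\<lambda>x. x" lborel] by (simp add: comp_def)
  from distributed_joint_indep[OF lborel.sigma_finite_measure_axioms lborel.sigma_finite_measure_axioms X Y this]
  have "distr M lborel (\<lambda>\<omega>. (X \<omega>, Y \<omega>)) = gauss_plane"
    by (simp add: distributed_def lborel_prod gauss_plane_def)
  moreover have "distr M borel (\<lambda>\<omega>. (X \<omega>, Y \<omega>)) = distr M lborel (\<lambda>\<omega>. (X \<omega>, Y \<omega>))"
    by (rule distr_cong) auto
  ultimately show ?thesis by simp
qed

text \<open>The blocks \<open>{Inl k, Inr k}\<close> are disjoint, so grouping the joint family by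
  \<open>k\<close> keeps independence across blocks; splitting one block into its two singletons
  gives independence within a pair.\<close>

lemma (in prob_space) indep_vars_pair:
  fixes X Y :: "'i \<Rightarrow> 'a \<Rightarrow> real"
  assumes indep: "indep_vars (\<lambda>_. borel) (\<lambda>i. case i of Inl k \<Rightarrow> X k | Inr k \<Rightarrow> Y k) (I <+> I)"
  shows "indep_vars (\<lambda>_. borel) (\<lambda>k \<omega>. (X k \<omega>, Y k \<omega>)) I"
    and "k \<in> I \<Longrightarrow> indep_var borel (X k) borel (Y k)"
proof -
  let ?Z = "\<lambda>i. case i of Inl k \<Rightarrow> X k | Inr k \<Rightarrow> Y k"
  have "indep_vars (\<lambda>k. Pi\<^sub>M {Inl k, Inr k} (\<lambda>_. borel)) (\<lambda>k \<omega>. restrict (\<lambda>i. ?Z i \<omega>) {Inl k, Inr k}) I"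
    by (rule indep_vars_restrict[OF indep]) (auto simp: disjoint_family_on_def)
  then have "indep_vars (\<lambda>_. borel) (\<lambda>k \<omega>. (\<lambda>k z. (z (Inl k), z (Inr k))) k (restrict (\<lambda>i. ?Z i \<omega>) {Inl k, Inr k})) I"
    by (rule indep_vars_compose2) (auto simp: borel_prod[symmetric])
  then show "indep_vars (\<lambda>_. borel) (\<lambda>k \<omega>. (X k \<omega>, Y k \<omega>)) I" by simp
  show "indep_var borel (X k) borel (Y k)" if "k \<in> I"
  proof -
    have "indep_var (Pi\<^sub>M {Inl k} (\<lambda>_. borel)) (\<lambda>\<omega>. restrict (\<lambda>i. ?Z i \<omega>) {Inl k})
      (Pi\<^sub>M {Inr k} (\<lambda>_. borel)) (\<lambda>\<omega>. restrict (\<lambda>i. ?Z i \<omega>) {Inr k})"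
      by (rule indep_var_restrict[OF indep]) (use that in auto)
    from indep_var_compose[OF this, of "\<lambda>z. z (Inl k)" borel "\<lambda>z. z (Inr k)" borel]
    show ?thesis by (simp add: comp_def)
  qed
qed

section \<open>The derivative of the criterion\<close>

text \<open>Let \<open>u\<close> and \<open>v\<close> be the coordinates of
  \<open>(xo k, xso k)\<close> rotated by minus \<open>2 * pi * real k * \<tau>\<close>. Then
  \<open>u\<close> has derivative \<open>2 * pi * real k * v\<close>, and the 2 from the square
  cancels the 1/2 in \<open>Phi\<close>.\<close>

lemma deriv_Phi:
  "deriv (Phi N xo xso h) \<tau> = (\<Sum>k\<in>{1..N}. h k * (2 * pi * real k *
     (xo k * cos (2 * pi * real k * \<tau>) + xso k * sin (2 * pi * real k * \<tau>)) *
     (xso k * cos (2 * pi * real k * \<tau>) - xo k * sin (2 * pi * real k * \<tau>))))"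
proof -
  define u where "u = (\<lambda>k t. xo k * cos (2 * pi * real k * t) + xso k * sin (2 * pi * real k * t))"
  define v where "v = (\<lambda>k t. xso k * cos (2 * pi * real k * t) - xo k * sin (2 * pi * real k * t))"
  have u: "(u k has_field_derivative 2 * pi * real k * v k \<tau>) (at \<tau>)" for k
    unfolding u_def v_def by (auto intro!: derivative_eq_intros simp: right_diff_distrib)
  have "((\<lambda>t. h k * (u k t)\<^sup>2) has_field_derivative 2 * (h k * (2 * pi * real k * u k \<tau> * v k \<tau>))) (at \<tau>)" for k
    by (auto intro!: derivative_eq_intros u)
  then have "((\<lambda>t. 1/2 * (\<Sum>k\<in>{1..N}. h k * (u k t)\<^sup>2)) has_field_derivative
      1/2 * (\<Sum>k\<in>{1..N}. 2 * (h k * (2 * pi * real k * u k \<tau> * v k \<tau>)))) (at \<tau>)"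
    by (intro DERIV_cmult DERIV_sum)
  then have "(Phi N xo xso h has_field_derivative
      (\<Sum>k\<in>{1..N}. h k * (2 * pi * real k * u k \<tau> * v k \<tau>))) (at \<tau>)"
    unfolding sum_distrib_left[symmetric] by (simp add: Phi_def[abs_def] u_def)
  then show ?thesis
    unfolding u_def v_def by (rule DERIV_imp_deriv)
qed

section \<open>A two-sided tail bound from exponential moments\<close>

text \<open>Markov's inequality for both tails at once: the indicator of the event is at most
  \<open>exp (- l * t) * (exp (l * Y \<omega>) + exp (- l * Y \<omega>))\<close>.\<close>

lemma (in prob_space) prob_abs_gt_le_exp_moments:
  fixes Y :: "'a \<Rightarrow> real"
  assumes [measurable]: "Y \<in> borel_measurable M" and "0 \<le> l" "0 \<le> B"
    and 1: "(\<integral>\<^sup>+\<omega>. ennreal (exp (l * Y \<omega>)) \<partial>M) \<le> ennreal B"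
    and 2: "(\<integral>\<^sup>+\<omega>. ennreal (exp (- l * Y \<omega>)) \<partial>M) \<le> ennreal B"
  shows "prob {\<omega> \<in> space M. \<bar>Y \<omega>\<bar> > t} \<le> 2 * (exp (- l * t) * B)"
proof -
  have *: "1 \<le> exp (- l * t) * (exp (l * Y \<omega>) + exp (- l * Y \<omega>))" if "\<bar>Y \<omega>\<bar> > t" for \<omega>
  proof -
    have "exp 0 \<le> exp (l * (\<bar>Y \<omega>\<bar> - t))"
      using that \<open>0 \<le> l\<close> unfolding exp_le_cancel_iff by simp
    also have "\<dots> = exp (- l * t) * exp (l * \<bar>Y \<omega>\<bar>)"
      by (simp add: exp_add[symmetric] algebra_simps)
    also have "\<dots> \<le> exp (- l * t) * (exp (l * Y \<omega>) + exp (- l * Y \<omega>))"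
      by (intro mult_left_mono) (auto simp: abs_if)
    finally show ?thesis by simp
  qed
  have "emeasure M {\<omega> \<in> space M. \<bar>Y \<omega>\<bar> > t} = (\<integral>\<^sup>+\<omega>. indicator {\<omega> \<in> space M. \<bar>Y \<omega>\<bar> > t} \<omega> \<partial>M)"
    by simp
  also have "\<dots> \<le> (\<integral>\<^sup>+\<omega>. ennreal (exp (- l * t)) * (ennreal (exp (l * Y \<omega>)) + ennreal (exp (- l * Y \<omega>))) \<partial>M)"
  proof (rule nn_integral_mono)
    fix \<omega>
    have "1 \<le> ennreal (exp (- l * t)) * (ennreal (exp (l * Y \<omega>)) + ennreal (exp (- l * Y \<omega>)))" if "\<bar>Y \<omega>\<bar> > t"
      using *[OF that] by (simp add: ennreal_mult'[symmetric] ennreal_plus[symmetric] del: ennreal_plus)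
    then show "indicator {\<omega> \<in> space M. \<bar>Y \<omega>\<bar> > t} \<omega>
        \<le> ennreal (exp (- l * t)) * (ennreal (exp (l * Y \<omega>)) + ennreal (exp (- l * Y \<omega>)))"
      by (auto simp: indicator_def)
  qed
  also have "\<dots> = ennreal (exp (- l * t)) *
      ((\<integral>\<^sup>+\<omega>. ennreal (exp (l * Y \<omega>)) \<partial>M) + (\<integral>\<^sup>+\<omega>. ennreal (exp (- l * Y \<omega>)) \<partial>M))"
    by (subst nn_integral_cmult, measurable, subst nn_integral_add) simp_all
  also have "\<dots> \<le> ennreal (exp (- l * t)) * (ennreal B + ennreal B)"
    by (intro mult_left_mono add_mono 1 2) auto
  also have "\<dots> = ennreal (2 * (exp (- l * t) * B))"
    using \<open>0 \<le> B\<close> by (simp add: ennreal_mult'[symmetric] ennreal_plus[symmetric] del: ennreal_plus)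
  finally show ?thesis
    using \<open>0 \<le> B\<close> by (simp add: emeasure_eq_measure)
qed

section \<open>Exponential moments under radial weights\<close>

text \<open>The source has coordinates only from 1 on while the target is indexed by all naturals,
  so index 0 receives the fixed value 0.\<close>

lemma measurable_squared_radii:
  fixes b :: "nat \<Rightarrow> real" and e :: real
  shows "(\<lambda>z k. if 1 \<le> k then (b k + e * fst (z k))\<^sup>2 + (e * snd (z k))\<^sup>2 else 0)
    \<in> Pi\<^sub>M {1..} (\<lambda>_. borel :: (real \<times> real) measure) \<rightarrow>\<^sub>M Pi\<^sub>M UNIV (\<lambda>_. borel)"
proof (rule measurable_PiM_single')
  fix k :: nat
  show "(\<lambda>z. if 1 \<le> k then (b k + e * fst (z k))\<^sup>2 + (e * snd (z k))\<^sup>2 else 0)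
    \<in> borel_measurable (Pi\<^sub>M {1..} (\<lambda>_. borel :: (real \<times> real) measure))"
  proof (cases "1 \<le> k")
    case True
    have "(\<lambda>z. z k) \<in> Pi\<^sub>M {1..} (\<lambda>_. borel) \<rightarrow>\<^sub>M (borel \<Otimes>\<^sub>M borel :: (real \<times> real) measure)"
      using measurable_component_singleton[of k "{1..}" "\<lambda>_. borel :: (real \<times> real) measure"] True
      by (simp add: borel_prod)
    from measurable_compose[OF this measurable_fst] measurable_compose[OF this measurable_snd] True
    show ?thesis by simp
  qed simp
qed auto

text \<open>The weights see only the squared radii, which are invariant under \<open>(x, y) \<mapsto> (x, - y)\<close>.\<close>
lemma (in prob_space) nn_integral_exp_radial_weights_le:
  fixes Q :: "nat \<Rightarrow> 'a \<Rightarrow> real \<times> real" and b :: "nat \<Rightarrow> real" and e l :: real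
  assumes indep: "indep_vars (\<lambda>_. borel) Q {1..}"
    and law: "\<And>k. k \<ge> 1 \<Longrightarrow> distr M borel (Q k) = gauss_plane"
    and H_meas: "\<And>k. (\<lambda>r. H r k) \<in> borel_measurable (Pi\<^sub>M UNIV (\<lambda>_. borel))"
    and H_range: "\<And>r k. 0 \<le> H r k \<and> H r k \<le> (1::real)"
    and small: "(l * (2 * pi * real N * e) * e)\<^sup>2 \<le> 1/6"
  shows "(\<integral>\<^sup>+\<omega>. ennreal (exp (l * (\<Sum>k\<in>{1..N}.
      H (\<lambda>k. if 1 \<le> k then (b k + e * fst (Q k \<omega>))\<^sup>2 + (e * snd (Q k \<omega>))\<^sup>2 else 0) k *
      (2 * pi * real k * (b k + e * fst (Q k \<omega>)) * (e * snd (Q k \<omega>)))))) \<partial>M)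
    \<le> ennreal (exp (3/5 * ((l * e)\<^sup>2 * (\<Sum>k\<in>{1..N}. (2 * pi * real k)\<^sup>2 * ((b k)\<^sup>2 + e\<^sup>2)))))"
proof -
  define a where "a = (\<lambda>k. l * (2 * pi * real k * e))"
  define g where "g = (\<lambda>k (z :: real \<times> real). a k * (b k + e * fst z) * snd z)"
  define r where "r = (\<lambda>(z :: nat \<Rightarrow> real \<times> real) k. if 1 \<le> k then (b k + e * fst (z k))\<^sup>2 + (e * snd (z k))\<^sup>2 else 0)"
  define w where "w = (\<lambda>k z. H (r z) k)"
  define \<sigma> where "\<sigma> = (\<lambda>(x :: real, y :: real). (x, - y))"
  have gm: "g k \<in> borel_measurable borel" for k
    unfolding g_def borel_prod[symmetric] by measurable
  have \<sigma>m[measurable]: "\<sigma> \<in> borel \<rightarrow>\<^sub>M borel"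
    unfolding \<sigma>_def borel_prod[symmetric] by measurable
  have rv[measurable]: "random_variable borel (Q k)" if "k \<ge> 1" for k
    using indep that by (auto simp: indep_vars_def)
  have r_inv: "r (z(j := \<sigma> (z j))) = r z" for z j
    by (auto simp: r_def \<sigma>_def fun_eq_iff case_prod_beta)
  have "l * (\<Sum>k\<in>{1..N}. H (r (\<lambda>k. Q k \<omega>)) k * (2 * pi * real k * (b k + e * fst (Q k \<omega>)) * (e * snd (Q k \<omega>))))
     = (\<Sum>k\<in>{1..N}. w k (\<lambda>i\<in>{1..}. Q i \<omega>) * g k (Q k \<omega>))" for \<omega>
  proof -
    \<comment> \<open>\<open>r\<close> never reads index 0, so restricting the family to
      \<open>{1..}\<close> is harmless; this puts the weights in the form of functions on the
      product space.\<close>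
    have "r (\<lambda>k. Q k \<omega>) = r (\<lambda>i\<in>{1..}. Q i \<omega>)" by (auto simp: r_def)
    then show ?thesis
      unfolding w_def g_def a_def sum_distrib_left by (intro sum.cong) (auto simp: algebra_simps)
  qed
  then have "(\<integral>\<^sup>+\<omega>. ennreal (exp (l * (\<Sum>k\<in>{1..N}. H (r (\<lambda>k. Q k \<omega>)) k *
      (2 * pi * real k * (b k + e * fst (Q k \<omega>)) * (e * snd (Q k \<omega>)))))) \<partial>M)
    = (\<integral>\<^sup>+\<omega>. ennreal (exp (\<Sum>k\<in>{1..N}. w k (\<lambda>i\<in>{1..}. Q i \<omega>) * g k (Q k \<omega>))) \<partial>M)"
    by simp
  also have "\<dots> \<le> (\<integral>\<^sup>+\<omega>. ennreal (exp (\<Sum>k\<in>{1..N}. g k (Q k \<omega>))) \<partial>M)"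
  proof (rule nn_integral_exp_weighted_odd_sum_le[OF indep _ _ \<sigma>m])
    fix k assume k: "k \<in> {1..N}"
    have "distr M borel (\<lambda>\<omega>. \<sigma> (Q k \<omega>)) = distr (distr M borel (Q k)) borel \<sigma>"
      using k by (subst distr_distr) (auto simp: comp_def rv)
    also have "\<dots> = distr M borel (Q k)"
      using k by (simp add: law \<sigma>_def distr_gauss_plane_reflection)
    finally show "distr M borel (\<lambda>\<omega>. \<sigma> (Q k \<omega>)) = distr M borel (Q k)" .
    show "w k \<in> borel_measurable (Pi\<^sub>M {1..} (\<lambda>_. borel))"
      unfolding w_def r_def by (rule measurable_compose[OF measurable_squared_radii H_meas])
  qed (auto simp: gm w_def r_inv H_range simp del: fun_upd_apply, auto simp: g_def \<sigma>_def case_prod_beta)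
  also have "\<dots> = (\<integral>\<^sup>+\<omega>. (\<Prod>k\<in>{1..N}. ennreal (exp (g k (Q k \<omega>)))) \<partial>M)"
    by (simp add: exp_sum prod_ennreal)
  \<comment> \<open>Once the weights are gone, each factor depends on its own pair only, so
    independence factors the expectation.\<close>
  also have "\<dots> = (\<Prod>k\<in>{1..N}. \<integral>\<^sup>+\<omega>. ennreal (exp (g k (Q k \<omega>))) \<partial>M)"
    by (intro indep_vars_nn_integral indep_vars_compose2[OF indep_vars_subset[OF indep]])
      (auto intro!: measurable_compose[OF gm])
  also have "\<dots> \<le> (\<Prod>k\<in>{1..N}. ennreal (exp (3/5 * ((a k)\<^sup>2 * (b k)\<^sup>2 + (a k)\<^sup>2 * e\<^sup>2))))"
  proof (rule prod_mono_ennreal)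
    fix k assume k: "k \<in> {1..N}"
    have "(\<integral>\<^sup>+\<omega>. ennreal (exp (g k (Q k \<omega>))) \<partial>M) = (\<integral>\<^sup>+z. ennreal (exp (g k z)) \<partial>distr M borel (Q k))"
      using k gm by (subst nn_integral_distr) (auto simp: rv)
    also have "\<dots> = (\<integral>\<^sup>+z. ennreal (exp (a k * (b k + e * fst z) * snd z)) \<partial>gauss_plane)"
      using k by (simp add: law g_def)
    also have "\<dots> \<le> ennreal (exp (3/5 * ((a k)\<^sup>2 * (b k)\<^sup>2 + (a k)\<^sup>2 * e\<^sup>2)))"
    proof (rule nn_integral_exp_product_gauss_plane_le)
      \<comment> \<open>The coefficient grows in absolute value with \<open>k\<close>, so the
        smallness assumption at \<open>N\<close> covers every index.\<close>
      have "(a k)\<^sup>2 * e\<^sup>2 = (l * (2 * pi) * e * e)\<^sup>2 * (real k)\<^sup>2"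
        by (simp add: a_def power_mult_distrib)
      also have "\<dots> \<le> (l * (2 * pi) * e * e)\<^sup>2 * (real N)\<^sup>2"
        using k by (intro mult_left_mono power_mono) auto
      also have "\<dots> = (l * (2 * pi * real N * e) * e)\<^sup>2"
        by (simp add: power_mult_distrib)
      finally show "(a k)\<^sup>2 * e\<^sup>2 \<le> 1/6" using small by simp
    qed
    finally show "(\<integral>\<^sup>+\<omega>. ennreal (exp (g k (Q k \<omega>))) \<partial>M) \<le> ennreal (exp (3/5 * ((a k)\<^sup>2 * (b k)\<^sup>2 + (a k)\<^sup>2 * e\<^sup>2)))" .
  qed
  also have "\<dots> = ennreal (exp (\<Sum>k\<in>{1..N}. 3/5 * ((a k)\<^sup>2 * (b k)\<^sup>2 + (a k)\<^sup>2 * e\<^sup>2)))"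
    by (simp add: exp_sum prod_ennreal)
  also have "(\<Sum>k\<in>{1..N}. 3/5 * ((a k)\<^sup>2 * (b k)\<^sup>2 + (a k)\<^sup>2 * e\<^sup>2))
    = 3/5 * ((l * e)\<^sup>2 * (\<Sum>k\<in>{1..N}. (2 * pi * real k)\<^sup>2 * ((b k)\<^sup>2 + e\<^sup>2)))"
    unfolding sum_distrib_left by (intro sum.cong refl) (simp add: a_def power_mult_distrib algebra_simps)
  finally show ?thesis unfolding r_def .
qed

section \<open>Signal and noise parts of the variance bound\<close>

text \<open>The signal part is a partial sum of the series for \<open>dnorm_sq f\<close>. In the
  noise part every \<open>k\<close> is bounded by \<open>N\<close>, which gives \<open>N\<close>
  equal terms and hence the power \<open>N ^ 3\<close>, the square of
  \<open>N powr (3/2)\<close>.\<close>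

lemma sum_deriv_weights_le:
  assumes summ: "summable (\<lambda>k. (2 * pi * real (Suc k))^2 * (fcoef f (Suc k))^2)"
  shows "(\<Sum>k\<in>{1..N}. (2 * pi * real k)\<^sup>2 * ((fcoef f k)\<^sup>2 + e\<^sup>2))
    \<le> (dnorm f)\<^sup>2 + (2 * pi * e * real N powr (3/2))\<^sup>2"
proof -
  have "(\<Sum>k\<in>{1..N}. (2 * pi * real k)\<^sup>2 * (fcoef f k)\<^sup>2) = (\<Sum>k<N. (2 * pi * real (Suc k))^2 * (fcoef f (Suc k))^2)"
    by (simp add: sum.atLeast1_atMost_eq)
  also have "\<dots> \<le> dnorm_sq f"
    unfolding dnorm_sq_def by (rule sum_le_suminf[OF summ]) auto
  finally have 1: "(\<Sum>k\<in>{1..N}. (2 * pi * real k)\<^sup>2 * (fcoef f k)\<^sup>2) \<le> dnorm_sq f" .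
  have "0 \<le> dnorm_sq f"
    unfolding dnorm_sq_def by (rule suminf_nonneg[OF summ]) auto
  then have D: "(dnorm f)\<^sup>2 = dnorm_sq f" by (simp add: dnorm_def)
  have "(\<Sum>k\<in>{1..N}. (2 * pi * real k)\<^sup>2 * e\<^sup>2) \<le> (\<Sum>k\<in>{1..N}. (2 * pi * real N)\<^sup>2 * e\<^sup>2)"
    by (intro sum_mono mult_right_mono power_mono) auto
  also have "\<dots> = (2 * pi * e)\<^sup>2 * real N ^ 3"
    by (simp add: power_mult_distrib power2_eq_square power3_eq_cube)
  also have "\<dots> = (2 * pi * e * real N powr (3/2))\<^sup>2"
    by (cases "N = 0") (simp_all add: power_mult_distrib powr_power powr_realpow[of "real N" 3, simplified])
  finally show ?thesis
    using 1 D by (simp add: distrib_left sum.distrib)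
qed

section \<open>The deviation inequality\<close>

theorem lemma2:
  fixes M :: "'a measure"
    and \<xi> \<xi>s :: "nat \<Rightarrow> 'a \<Rightarrow> real"
    and f :: "real \<Rightarrow> real"
    and \<theta> eps x :: real
    and N :: nat
    and H :: "(nat \<Rightarrow> real) \<Rightarrow> nat \<Rightarrow> real"
  assumes P: "prob_space M"
    and indep: "prob_space.indep_vars M (\<lambda>_. borel)
                  (\<lambda>i. case i of Inl k \<Rightarrow> \<xi> k | Inr k \<Rightarrow> \<xi>s k) ({1..} <+> {1..})"
    and gauss1: "\<And>k. k \<ge> 1 \<Longrightarrow> distributed M lborel (\<xi> k) std_normal_density"
    and gauss2: "\<And>k. k \<ge> 1 \<Longrightarrow> distributed M lborel (\<xi>s k) std_normal_density"
    and f_meas: "f \<in> borel_measurable lborel"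
    and f_L2loc: "\<And>a b. set_integrable lborel {a..b} (\<lambda>t. (f t)^2)"
    and f_even: "\<And>t. f (- t) = f t"
    and f_per: "\<And>t. f (t + 1) = f t"
    and f_deriv_fin: "summable (\<lambda>k. (2 * pi * real (Suc k))^2 * (fcoef f (Suc k))^2)"
    and eps_rng: "0 < eps" "eps < 1"
    and N: "N \<ge> 1"
    and H_meas: "\<And>k. (\<lambda>r. H r k) \<in> borel_measurable (PiM UNIV (\<lambda>_. borel))"
    and H_range: "\<And>r k. 0 \<le> H r k \<and> H r k \<le> 1"
    and H_supp: "\<And>r k. k \<notin> {1..N} \<Longrightarrow> H r k = 0"
    and x: "0 \<le> x" "x \<le> sqrt (real N / 6)"
  shows "measure M {\<omega> \<in> space M.
           let xo = (\<lambda>k. fcoef f k * cos (2 * pi * real k * \<theta>) + eps * \<xi> k \<omega>);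
               xso = (\<lambda>k. fcoef f k * sin (2 * pi * real k * \<theta>) + eps * \<xi>s k \<omega>);
               h = H (\<lambda>k. if 1 \<le> k then (xo k)^2 + (xso k)^2 else 0)
           in \<bar>deriv (Phi N xo xso h) \<theta>\<bar>
                > 2 * x * eps * (dnorm f + 2 * pi * eps * real N powr (3/2))}
         \<le> 2 * exp (- (x^2))"
proof -
  interpret prob_space M by fact
  define c where "c = (\<lambda>k. cos (2 * pi * real k * \<theta>))"
  define s where "s = (\<lambda>k. sin (2 * pi * real k * \<theta>))"
  have cs: "c k * c k + s k * s k = 1" for k
    using sin_cos_squared_add3 by (simp add: c_def s_def)
  define b where "b = fcoef f"
  \<comment> \<open>The noise pair is rotated by minus \<open>2 * pi * real k * \<theta>\<close>;
    the sine enters as \<open>- s k\<close> so that the map has literally the form of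
    \<open>distr_gauss_plane_rotation\<close>.\<close>
  define Q where "Q = (\<lambda>k \<omega>. (\<lambda>(x, y). (c k * x - (- s k) * y, - s k * x + c k * y)) (\<xi> k \<omega>, \<xi>s k \<omega>))"
  have rot_meas: "(\<lambda>(x, y). (c k * x - (- s k) * y, - s k * x + c k * y)) \<in> borel \<rightarrow>\<^sub>M borel" for k
    unfolding borel_prod[symmetric] by measurable
  have indepP: "indep_vars (\<lambda>_. borel) (\<lambda>k \<omega>. (\<xi> k \<omega>, \<xi>s k \<omega>)) {1..}"
    by (rule indep_vars_pair(1)[OF indep])
  have indepQ: "indep_vars (\<lambda>_. borel) Q {1..}"
    unfolding Q_def by (rule indep_vars_compose2[OF indepP rot_meas])
  have lawQ: "distr M borel (Q k) = gauss_plane" if k: "k \<ge> 1" for k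
  proof -
    have "random_variable borel (\<lambda>\<omega>. (\<xi> k \<omega>, \<xi>s k \<omega>))"
      using indepP k by (auto simp: indep_vars_def)
    then have "distr M borel (Q k) = distr (distr M borel (\<lambda>\<omega>. (\<xi> k \<omega>, \<xi>s k \<omega>))) borel
        (\<lambda>(x, y). (c k * x - (- s k) * y, - s k * x + c k * y))"
      by (subst distr_distr[OF rot_meas]) (simp_all add: Q_def[abs_def] comp_def)
    also have "distr M borel (\<lambda>\<omega>. (\<xi> k \<omega>, \<xi>s k \<omega>)) = gauss_plane"
      using k by (intro distr_std_normal_pair gauss1 gauss2 indep_vars_pair(2)[OF indep]) auto
    also have "distr gauss_plane borel (\<lambda>(x, y). (c k * x - (- s k) * y, - s k * x + c k * y)) = gauss_plane"
      by (rule distr_gauss_plane_rotation) (simp add: power2_eq_square cs)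
    finally show ?thesis .
  qed
  define r where "r = (\<lambda>(z :: nat \<Rightarrow> real \<times> real) k. if 1 \<le> k then (b k + eps * fst (z k))\<^sup>2 + (eps * snd (z k))\<^sup>2 else 0)"
  define Y where "Y = (\<lambda>\<omega>. \<Sum>k\<in>{1..N}. H (r (\<lambda>k. Q k \<omega>)) k *
      (2 * pi * real k * (b k + eps * fst (Q k \<omega>)) * (eps * snd (Q k \<omega>))))"
  \<comment> \<open>In the rotated frame the signal lies on the first axis: the observation pair
    becomes \<open>(b k + eps * fst (Q k \<omega>), eps * snd (Q k \<omega>))\<close>. Its length is
    unchanged, so the weights can be read off from \<open>Q\<close>.\<close>
  have deriv_eq: "(let xo = (\<lambda>k. fcoef f k * cos (2 * pi * real k * \<theta>) + eps * \<xi> k \<omega>);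
               xso = (\<lambda>k. fcoef f k * sin (2 * pi * real k * \<theta>) + eps * \<xi>s k \<omega>);
               h = H (\<lambda>k. if 1 \<le> k then (xo k)^2 + (xso k)^2 else 0)
           in \<bar>deriv (Phi N xo xso h) \<theta>\<bar> > t) \<longleftrightarrow> \<bar>Y \<omega>\<bar> > t" for \<omega> t
  proof -
    have 1: "(b k * c k + eps * \<xi> k \<omega>) * c k + (b k * s k + eps * \<xi>s k \<omega>) * s k = b k + eps * fst (Q k \<omega>)" for k
    proof -
      have "(b k * c k + eps * \<xi> k \<omega>) * c k + (b k * s k + eps * \<xi>s k \<omega>) * s k
        = b k * (c k * c k + s k * s k) + eps * (c k * \<xi> k \<omega> + s k * \<xi>s k \<omega>)"
        by (simp add: algebra_simps)
      then show ?thesis by (simp add: cs Q_def)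
    qed
    have 2: "(b k * s k + eps * \<xi>s k \<omega>) * c k - (b k * c k + eps * \<xi> k \<omega>) * s k = eps * snd (Q k \<omega>)" for k
      by (simp add: Q_def algebra_simps)
    have "(b k * c k + eps * \<xi> k \<omega>)\<^sup>2 + (b k * s k + eps * \<xi>s k \<omega>)\<^sup>2
        = (b k + eps * fst (Q k \<omega>))\<^sup>2 + (eps * snd (Q k \<omega>))\<^sup>2" for k
    proof -
      have "(p * c k + q * s k)\<^sup>2 + (q * c k - p * s k)\<^sup>2 = (p\<^sup>2 + q\<^sup>2) * (c k * c k + s k * s k)" for p q
        by (simp add: power2_eq_square algebra_simps)
      then show ?thesis unfolding 1[symmetric] 2[symmetric] by (simp add: cs)
    qed
    then have 3: "(\<lambda>k. if 1 \<le> k then (b k * c k + eps * \<xi> k \<omega>)\<^sup>2 + (b k * s k + eps * \<xi>s k \<omega>)\<^sup>2 else 0)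
      = r (\<lambda>k. Q k \<omega>)" by (simp add: r_def cong: if_cong)
    show ?thesis
      unfolding Let_def deriv_Phi Y_def
      unfolding b_def[symmetric] c_def[symmetric, THEN fun_cong] s_def[symmetric, THEN fun_cong] 1 2 3 ..
  qed
  have Y_meas: "Y \<in> borel_measurable M"
  proof -
    have rv: "random_variable borel (Q k)" if "k \<ge> 1" for k
      using indepQ that by (auto simp: indep_vars_def)
    have rv2: "(\<lambda>\<omega>. fst (Q k \<omega>)) \<in> borel_measurable M" "(\<lambda>\<omega>. snd (Q k \<omega>)) \<in> borel_measurable M" if "k \<ge> 1" for k
      using measurable_compose[OF _ measurable_fst, of "Q k" M borel borel]
        measurable_compose[OF _ measurable_snd, of "Q k" M borel borel] rv[OF that]
      by (simp_all add: borel_prod)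
    \<comment> \<open>The detour through the restricted family places the argument of
      \<open>r\<close> in the product space over \<open>{1..}\<close>.\<close>
    have "(\<lambda>\<omega>. r (\<lambda>i\<in>{1..}. Q i \<omega>)) \<in> M \<rightarrow>\<^sub>M Pi\<^sub>M UNIV (\<lambda>_. borel)"
      unfolding r_def
      by (rule measurable_compose[OF _ measurable_squared_radii]) (intro measurable_restrict rv, simp)
    also have "(\<lambda>\<omega>. r (\<lambda>i\<in>{1..}. Q i \<omega>)) = (\<lambda>\<omega>. r (\<lambda>k. Q k \<omega>))"
      by (auto simp: r_def fun_eq_iff)
    finally have "(\<lambda>\<omega>. H (r (\<lambda>k. Q k \<omega>)) k) \<in> borel_measurable M" for k
      by (rule measurable_compose[OF _ H_meas])
    then show ?thesis
      unfolding Y_def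
      by (intro borel_measurable_sum borel_measurable_times borel_measurable_add borel_measurable_const rv2) auto
  qed
  define D where "D = dnorm f"
  define G where "G = 2 * pi * eps * real N powr (3/2)"
  have D: "D \<ge> 0"
    unfolding D_def dnorm_def dnorm_sq_def
    by (intro real_sqrt_ge_zero suminf_nonneg[OF f_deriv_fin]) simp
  have G: "G > 0" using eps_rng N by (simp add: G_def)
  have G_eq: "G = 2 * pi * eps * real N * sqrt (real N)"
    using N powr_add[of "real N" 1 "1/2"] by (simp add: G_def powr_half_sqrt)
  \<comment> \<open>This \<open>l\<close> minimises the exponent
    \<open>- l * t + (l * eps * (D + G))\<^sup>2\<close> at
    \<open>t = 2 * x * eps * (D + G)\<close>; the minimum is \<open>- x\<^sup>2\<close>.\<close>
  define l where "l = x / (eps * (D + G))"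
  have l: "l \<ge> 0" using x eps_rng D G by (simp add: l_def)
  have le: "l * eps = x / (D + G)" using eps_rng by (simp add: l_def)
  \<comment> \<open>Here the range of \<open>x\<close> enters: dropping \<open>D\<close> from the
    denominator leaves \<open>x / sqrt (real N)\<close>, because \<open>G\<close> is
    \<open>2 * pi * eps * real N * sqrt (real N)\<close>.\<close>
  have small: "(l * (2 * pi * real N * eps) * eps)\<^sup>2 \<le> 1/6"
  proof -
    have "l * (2 * pi * real N * eps) * eps = x / (D + G) * (2 * pi * real N * eps)"
      unfolding le[symmetric] by (simp add: mult_ac)
    also have "\<dots> \<le> x / G * (2 * pi * real N * eps)"
      using x D G eps_rng by (intro mult_right_mono divide_left_mono) auto
    also have "\<dots> = x / sqrt (real N)"
      using eps_rng N by (simp add: G_eq)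
    also have "\<dots> \<le> sqrt (real N / 6) / sqrt (real N)"
      using x by (intro divide_right_mono) auto
    also have "\<dots> = sqrt (1/6)"
      using N by (simp add: real_sqrt_divide)
    finally have "(l * (2 * pi * real N * eps) * eps)\<^sup>2 \<le> (sqrt (1/6))\<^sup>2"
      using l eps_rng by (intro power_mono) auto
    then show ?thesis by simp
  qed
  define V where "V = (\<Sum>k\<in>{1..N}. (2 * pi * real k)\<^sup>2 * ((b k)\<^sup>2 + eps\<^sup>2))"
  have "3/5 * ((l * eps)\<^sup>2 * V) \<le> x\<^sup>2"
  proof -
    have "V \<le> D\<^sup>2 + G\<^sup>2"
      unfolding V_def b_def D_def G_def by (rule sum_deriv_weights_le[OF f_deriv_fin])
    also have "\<dots> \<le> (D + G)\<^sup>2" using D G by (simp add: power2_sum)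
    finally have "(l * eps)\<^sup>2 * V \<le> (l * eps)\<^sup>2 * (D + G)\<^sup>2"
      by (rule mult_left_mono) simp
    also have "\<dots> = x\<^sup>2" using D G by (simp add: le power_divide)
    finally have "(l * eps)\<^sup>2 * V \<le> x\<^sup>2" .
    \<comment> \<open>The factor 3/5 is simply bounded by 1.\<close>
    then show ?thesis using zero_le_power2[of x] by linarith
  qed
  then have V: "ennreal (exp (3/5 * ((l * eps)\<^sup>2 * V))) \<le> ennreal (exp (x\<^sup>2))"
    by (intro ennreal_leI) simp
  \<comment> \<open>Only the square of \<open>l'\<close> enters the bound, so one estimate serves
    both tails.\<close>
  have mgf: "(\<integral>\<^sup>+\<omega>. ennreal (exp (l' * Y \<omega>)) \<partial>M) \<le> ennreal (exp (x\<^sup>2))" if "\<bar>l'\<bar> = l" for l'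
  proof -
    have l': "l'\<^sup>2 = l\<^sup>2" using that by (metis power2_abs)
    then have "(l' * (2 * pi * real N * eps) * eps)\<^sup>2 \<le> 1/6"
      using small by (simp add: power_mult_distrib)
    then have "(\<integral>\<^sup>+\<omega>. ennreal (exp (l' * Y \<omega>)) \<partial>M) \<le> ennreal (exp (3/5 * ((l' * eps)\<^sup>2 * V)))"
      unfolding Y_def V_def r_def
      by (intro nn_integral_exp_radial_weights_le indepQ lawQ H_meas H_range)
    also have "\<dots> = ennreal (exp (3/5 * ((l * eps)\<^sup>2 * V)))"
      by (simp add: power_mult_distrib l')
    finally show ?thesis using V by (rule order_trans)
  qed
  have "prob {\<omega> \<in> space M. \<bar>Y \<omega>\<bar> > 2 * x * eps * (D + G)} \<le> 2 * (exp (- l * (2 * x * eps * (D + G))) * exp (x\<^sup>2))"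
    using mgf[of l] mgf[of "- l"] l by (intro prob_abs_gt_le_exp_moments[OF Y_meas l]) simp_all
  \<comment> \<open>Since \<open>l * eps * (D + G) = x\<close>, the Markov factor contributes
    \<open>- 2 * x\<^sup>2\<close> and the moment bound gives back \<open>x\<^sup>2\<close>.\<close>
  also have "- l * (2 * x * eps * (D + G)) = - (2 * x\<^sup>2)"
  proof -
    have "- l * (2 * x * eps * (D + G)) = - (2 * x * (l * eps * (D + G)))" by simp
    also have "l * eps * (D + G) = x" using D G by (simp add: le)
    finally show ?thesis by (simp add: power2_eq_square)
  qed
  also have "exp (- (2 * x\<^sup>2)) * exp (x\<^sup>2) = exp (- x\<^sup>2)"
    by (simp add: exp_add[symmetric])
  finally show ?thesis
    unfolding deriv_eq D_def G_def .
qed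

end
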